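(* Let $N\ge 2$. There exists a compactly supported function $f:\mathbb{R}^N\to\mathbb{R}$ which is differentiable (at every point) and $1$-Lipschitz for the Euclidean norm, such that for every convex body $K$ contained in the closed Euclidean unit ball $\overline{B}(0,1)$ of $\mathbb{R}^N$ there exists $x\in\mathbb{R}^N$ with $\partial f(x)=K$.
   Context: A convex body is a compact convex set with nonempty interior. $\mathbb{R}^N$ carries its Euclidean structure, and derivatives are identified with gradients, so that subdifferentials are subsets of $\mathbb{R}^N$. For a locally Lipschitz function $f:\mathbb{R}^N\to\mathbb{R}$, let $\mathcal{D}_f$ be the (full measure) set of points where $f$ is differentiable. The Clarke subdifferential of $f$ at $x$ is $$\partial f(x)=\mathrm{conv}\Big\{\lim_{n\to\infty} \nabla f(x_n)\,:\ x_n\to x,\ \{x_n\}\subset\mathcal{D}_f\setminus\mathcal{N},\ \text{the limit exists}\Big\},$$ where $\mathcal{N}$ is any Lebesgue-null set (the definition does not depend on the choice of $\mathcal{N}$) and $\mathrm{conv}$ denotes the convex hull. *)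

theory Defs
  imports "HOL-Analysis.Analysis"
begin

definition convex_body :: "'a::euclidean_space set \<Rightarrow> bool" where
  "convex_body K \<longleftrightarrow> convex K \<and> compact K \<and> interior K \<noteq> {}"

definition compactly_supported :: "('a::euclidean_space \<Rightarrow> real) \<Rightarrow> bool" where
  "compactly_supported f \<longleftrightarrow> compact (closure {x. f x \<noteq> 0})"

(* Unspecified at points where f is not differentiable. *)
definition gradient :: "('a::euclidean_space \<Rightarrow> real) \<Rightarrow> 'a \<Rightarrow> 'a" where
  "gradient f x = (THE D. GDERIV f x :> D)"

lemma gderiv_unique:
  fixes f :: "'a::euclidean_space \<Rightarrow> real"
  assumes "GDERIV f x :> D" "GDERIV f x :> E"
  shows "D = E"
proof -
  have "(\<lambda>h. inner h D) = (\<lambda>h. inner h E)"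
    using assms has_derivative_unique unfolding gderiv_def by blast
  then show ?thesis
    by (metis vector_eq_ldot)
qed

lemma gradient_eq:
  fixes f :: "'a::euclidean_space \<Rightarrow> real"
  assumes "GDERIV f x :> D"
  shows "gradient f x = D"
  unfolding gradient_def using assms gderiv_unique by blast

lemma gderiv_gradient:
  fixes f :: "'a::euclidean_space \<Rightarrow> real"
  assumes "f differentiable (at x)"
  shows "GDERIV f x :> gradient f x"
proof -
  obtain f' where f': "(f has_derivative f') (at x)"
    using assms unfolding differentiable_def by blast
  then have "linear f'"
    by (rule has_derivative_linear)
  then have "f' = (\<lambda>h. inner h (adjoint f' 1))"
    using adjoint_works[of f' _ 1] by (auto simp: fun_eq_iff)
  with f' have "GDERIV f x :> adjoint f' 1"
    unfolding gderiv_def by metis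
  then show ?thesis
    using gradient_eq by metis
qed

(* The null set avoided by the approximating sequences is kept as the parameter N. For locally
   Lipschitz f and Lebesgue-null N the result does not depend on N. *)
definition clarke_subdifferential ::
    "'a::euclidean_space set \<Rightarrow> ('a \<Rightarrow> real) \<Rightarrow> 'a \<Rightarrow> 'a set" where
  "clarke_subdifferential N f x =
     convex hull {p. \<exists>X. X \<longlonglongrightarrow> x \<and> range X \<subseteq> {y. f differentiable (at y)} - N \<and>
                         (\<lambda>n. gradient f (X n)) \<longlonglongrightarrow> p}"

end

theory Submission
  imports Defs
begin

text \<open>
  Encode a compact set K by a real number code K so that K' is contained in a small neighbourhood
  of K whenever code K' is close to code K. For p in the open unit ball take a bump function that
  equals \<open>x \<mapsto> p \<bullet> x\<close> near the origin, and let each body K having p in its interior correspond to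
  the point code K on an axis. Perturb the linear part by tiny disjoint bumps accumulating at this
  axis from the side (this is where the dimension is at least 2), so small compared with their
  distance to the axis that the sum stays differentiable there with gradient p. A bump lying close
  to code L has gradients in L - p and gradient constantly q - p on a small ball, where the pairs
  (code L, q), with q interior to L, run through a dense sequence. Hence the gradients near code K
  approach K and only K. Finally glue scaled copies of these functions for a dense set of points p.
\<close>

section \<open>Clarke subdifferentials from gradients prescribed on open sets\<close>

text \<open>
  Gradients are prescribed up to \<open>\<epsilon>\<close> on open sets, so that removing a null set is harmless.
\<close>
definition realizes :: "('a::euclidean_space \<Rightarrow> 'a) \<Rightarrow> 'a set \<Rightarrow> 'a \<Rightarrow> bool" where
  "realizes G K x \<longleftrightarrow>
     (\<forall>\<epsilon>>0. \<exists>\<delta>>0. \<forall>y\<in>ball x \<delta>. \<exists>z\<in>K. dist (G y) z < \<epsilon>) \<and>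
     (\<forall>q\<in>K. \<forall>\<epsilon>>0. \<exists>U. open U \<and> U \<noteq> {} \<and> U \<subseteq> ball x \<epsilon> \<and> (\<forall>y\<in>U. dist (G y) q < \<epsilon>))"

text \<open>Closedness of \<open>K\<close> keeps all limits of gradients inside \<open>K\<close>.
  Conversely, the open sets supplied by \<open>realizes\<close> are nonempty, hence not null, so
  points approximating any \<open>q\<close> in \<open>K\<close> can be chosen outside
  \<open>N\<close>. The set of limits is thus exactly \<open>K\<close>, and the convex hull adds
  nothing.\<close>

lemma clarke_subdifferential_eq_if_realizes:
  fixes f :: "'a::euclidean_space \<Rightarrow> real"
  assumes f: "\<And>y. GDERIV f y :> G y"
    and K: "convex K" "compact K"
    and R: "realizes G K x"
    and N: "N \<in> null_sets lebesgue"
  shows "clarke_subdifferential N f x = K"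
proof -
  define S where "S = {p. \<exists>X. X \<longlonglongrightarrow> x \<and> range X \<subseteq> {y. f differentiable (at y)} - N \<and>
                         (\<lambda>n. gradient f (X n)) \<longlonglongrightarrow> p}"
  have grad: "gradient f y = G y" for y
    using f gradient_eq by blast
  have diff: "f differentiable (at y)" for y
    using f unfolding gderiv_def differentiable_def by blast
  have "S \<subseteq> K"
  proof
    fix p assume "p \<in> S"
    then obtain X where X: "X \<longlonglongrightarrow> x" "(\<lambda>n. G (X n)) \<longlonglongrightarrow> p"
      by (auto simp: S_def grad)
    have "\<exists>z\<in>K. dist z p < \<epsilon>" if \<epsilon>: "\<epsilon> > 0" for \<epsilon>
    proof -
      obtain \<delta> where \<delta>: "\<delta> > 0" "\<And>y. y \<in> ball x \<delta> \<Longrightarrow> \<exists>z\<in>K. dist (G y) z < \<epsilon>/2"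
        using R half_gt_zero[OF \<epsilon>] unfolding realizes_def by meson
      have "\<forall>\<^sub>F n in sequentially. dist (X n) x < \<delta> \<and> dist (G (X n)) p < \<epsilon>/2"
        using tendstoD[OF X(1) \<delta>(1)] tendstoD[OF X(2), of "\<epsilon>/2"] \<epsilon>
        by (auto intro: eventually_conj)
      then obtain n where n: "dist (X n) x < \<delta>" "dist (G (X n)) p < \<epsilon>/2"
        using eventually_happens'[OF sequentially_bot] by blast
      then obtain z where "z \<in> K" "dist (G (X n)) z < \<epsilon>/2"
        using \<delta>(2)[of "X n"] by (auto simp: dist_commute)
      with n show ?thesis
        by (metis dist_commute dist_triangle_half_l)
    qed
    then have "p \<in> closure K"
      by (simp add: closure_approachable)
    then show "p \<in> K"
      using K(2) by (simp add: compact_imp_closed)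
  qed
  moreover have "K \<subseteq> S"
  proof
    fix q assume q: "q \<in> K"
    have "\<exists>y. y \<notin> N \<and> dist x y < inverse (Suc n) \<and> dist (G y) q < inverse (Suc n)" for n
    proof -
      obtain U where U: "open U" "U \<noteq> {}" "U \<subseteq> ball x (inverse (Suc n))"
        "\<forall>y\<in>U. dist (G y) q < inverse (Suc n)"
        using R q unfolding realizes_def by (metis inverse_positive_iff_positive of_nat_0_less_iff zero_less_Suc)
      have "\<not> U \<subseteq> N"
        using N U(1,2) by (metis negligible_iff_null_sets negligible_subset open_not_negligible)
      with U show ?thesis by force
    qed
    then obtain X where X: "\<And>n. X n \<notin> N \<and> dist x (X n) < inverse (Suc n) \<and>
        dist (G (X n)) q < inverse (Suc n)"
      by metis
    have "X \<longlonglongrightarrow> x"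
      unfolding tendsto_dist_iff[of X]
      by (rule tendsto_sandwich[OF _ _ tendsto_const LIMSEQ_inverse_real_of_nat])
        (use X in \<open>auto simp: dist_commute intro!: always_eventually less_imp_le\<close>)
    moreover have "(\<lambda>n. G (X n)) \<longlonglongrightarrow> q"
      unfolding tendsto_dist_iff[of "\<lambda>n. G (X n)"]
      by (rule tendsto_sandwich[OF _ _ tendsto_const LIMSEQ_inverse_real_of_nat])
        (use X in \<open>auto intro!: always_eventually less_imp_le\<close>)
    ultimately show "q \<in> S"
      unfolding S_def grad using X diff by auto
  qed
  ultimately have "S = K" by simp
  then show ?thesis
    unfolding clarke_subdifferential_def S_def[symmetric] using K(1) by (simp add: hull_same)
qed

section \<open>Rescaling and Lipschitz bounds\<close>

text \<open>Scaling a function together with its argument moves points but keeps gradient values.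
  Asking for equality of the gradient fields only near the new point makes this applicable to glued
  functions.\<close>

lemma realizes_rescale:
  fixes a :: "'a::euclidean_space"
  assumes R: "realizes G K x" and r: "r > 0" and d: "d > 0"
    and eq: "\<And>y. y \<in> ball (a + r *\<^sub>R x) d \<Longrightarrow> G' y = G ((y - a) /\<^sub>R r)"
  shows "realizes G' K (a + r *\<^sub>R x)"
proof -
  have sc: "dist (a + r *\<^sub>R x) y = r * dist x ((y - a) /\<^sub>R r)" for y
  proof -
    have "a + r *\<^sub>R x - y = r *\<^sub>R (x - (y - a) /\<^sub>R r)"
      using r by (simp add: algebra_simps)
    then show ?thesis
      using r by (simp add: dist_norm)
  qed
  show ?thesis
    unfolding realizes_def
  proof (intro conjI allI ballI impI)
    fix \<epsilon> :: real assume "\<epsilon> > 0"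
    then obtain \<delta> where \<delta>: "\<delta> > 0" "\<And>y. y \<in> ball x \<delta> \<Longrightarrow> \<exists>z\<in>K. dist (G y) z < \<epsilon>"
      using R unfolding realizes_def by meson
    have "\<exists>z\<in>K. dist (G' y) z < \<epsilon>" if "y \<in> ball (a + r *\<^sub>R x) (min d (r * \<delta>))" for y
      using that \<delta>(2)[of "(y - a) /\<^sub>R r"] eq[of y] r sc[of y] by auto
    then show "\<exists>\<delta>>0. \<forall>y\<in>ball (a + r *\<^sub>R x) \<delta>. \<exists>z\<in>K. dist (G' y) z < \<epsilon>"
      using r d \<delta>(1) by (intro exI[of _ "min d (r * \<delta>)"]) auto
  next
    fix q and \<epsilon> :: real assume q: "q \<in> K" and \<epsilon>: "\<epsilon> > 0"
    \<comment> \<open>The bound \<open>min d \<epsilon> / r\<close> keeps the rescaled open set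
      inside the balls of radius \<open>d\<close> and \<open>\<epsilon>\<close>; the bound
      \<open>\<epsilon>\<close> controls the gradients.\<close>
    define \<eta> where "\<eta> = min \<epsilon> (min d \<epsilon> / r)"
    have "\<eta> \<le> min d \<epsilon> / r"
      by (simp add: \<eta>_def)
    then have "r * \<eta> \<le> min d \<epsilon>"
      using r by (simp add: pos_le_divide_eq mult.commute)
    then have \<eta>: "\<eta> > 0" "\<eta> \<le> \<epsilon>" "r * \<eta> \<le> d" "r * \<eta> \<le> \<epsilon>"
      using \<epsilon> d r by (auto simp: \<eta>_def)
    obtain U where U: "open U" "U \<noteq> {}" "U \<subseteq> ball x \<eta>" "\<forall>y\<in>U. dist (G y) q < \<eta>"
      using R q \<eta>(1) unfolding realizes_def by meson
    let ?g = "\<lambda>y. (y - a) /\<^sub>R r"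
    define V where "V = ?g -` U"
    have "open V"
      unfolding V_def using U(1) by (intro open_vimage continuous_intros) auto
    moreover have "V \<noteq> {}"
    proof -
      obtain u where "u \<in> U" using U(2) by auto
      then have "a + r *\<^sub>R u \<in> V" using r by (simp add: V_def)
      then show ?thesis by auto
    qed
    moreover have "y \<in> ball (a + r *\<^sub>R x) (r * \<eta>)" if "y \<in> V" for y
      using that U(3) r sc[of y] by (auto simp: V_def)
    moreover from this have "dist (G' y) q < \<epsilon>" if "y \<in> V" for y
      using that U(4) eq[of y] \<eta> by (force simp: V_def)
    ultimately show "\<exists>U. open U \<and> U \<noteq> {} \<and> U \<subseteq> ball (a + r *\<^sub>R x) \<epsilon> \<and> (\<forall>y\<in>U. dist (G' y) q < \<epsilon>)"
      using \<eta> by (intro exI[of _ V]) force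
  qed
qed

text \<open>The outer factor \<open>r\<close> cancels the \<open>1/r\<close> of the chain rule, so
  bumps can be shrunk at will without changing the range of their gradients.\<close>

lemma GDERIV_rescale:
  assumes "GDERIV \<phi> ((x - a) /\<^sub>R r) :> D" and "r > 0"
  shows "GDERIV (\<lambda>x. r * \<phi> ((x - a) /\<^sub>R r)) x :> D"
proof -
  have "((\<lambda>x. (x - a) /\<^sub>R r) has_derivative (\<lambda>h. h /\<^sub>R r)) (at x)"
    by (auto intro!: derivative_eq_intros)
  from has_derivative_compose[OF this assms(1)[unfolded gderiv_def]]
  have "((\<lambda>x. r * \<phi> ((x - a) /\<^sub>R r)) has_derivative (\<lambda>h. r * ((h /\<^sub>R r) \<bullet> D))) (at x)"
    by (intro has_derivative_mult_right)
  then show ?thesis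
    using assms(2) by (simp add: gderiv_def mult.assoc[symmetric])
qed

lemma GDERIV_transform_open:
  assumes "GDERIV f x :> D" "open S" "x \<in> S" "\<And>y. y \<in> S \<Longrightarrow> f y = g y"
  shows "GDERIV g x :> D"
  using assms unfolding gderiv_def by (blast intro: has_derivative_transform_within_open)

lemma GDERIV_bound_imp_lipschitz:
  fixes f :: "'a::real_inner \<Rightarrow> real"
  assumes "\<And>y. GDERIV f y :> G y" "\<And>y. norm (G y) \<le> 1"
  shows "1-lipschitz_on UNIV f"
proof (rule bounded_derivative_imp_lipschitz)
  show "(f has_derivative (\<lambda>h. h \<bullet> G y)) (at y within UNIV)" for y
    using assms(1) by (simp add: gderiv_def)
  show "onorm (\<lambda>h. h \<bullet> G y) \<le> 1" for y
  proof (rule onorm_bound)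
    show "norm (h \<bullet> G y) \<le> 1 * norm h" for h
      using Cauchy_Schwarz_ineq2[of h "G y"] mult_left_mono[OF assms(2)[of y] norm_ge_zero[of h]]
      by simp
  qed simp
qed auto

section \<open>Coding sets by ternary digits\<close>

text \<open>Base 3 with digits 0 and 1 leaves gaps between codes, so that nearby codes share their
  leading digits; binary expansions would not give this.\<close>

definition cantor_code :: "(nat \<Rightarrow> bool) \<Rightarrow> real" where
  "cantor_code b = (\<Sum>i. of_bool (b i) / 3 ^ i)"

lemma cantor_code_summable: "summable (\<lambda>i. of_bool (b i) / 3 ^ i :: real)"
proof (rule summable_comparison_test')
  show "summable (\<lambda>i. (1/3::real) ^ i)" by (simp add: summable_geometric)
qed (auto simp: power_divide)

lemma cantor_code_bounds: "0 \<le> cantor_code b" "cantor_code b \<le> 3/2"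
proof -
  show "0 \<le> cantor_code b"
    unfolding cantor_code_def by (intro suminf_nonneg cantor_code_summable) auto
  have "cantor_code b \<le> (\<Sum>i. (1/3::real) ^ i)"
    unfolding cantor_code_def
    by (intro suminf_le cantor_code_summable summable_geometric) (auto simp: power_divide)
  then show "cantor_code b \<le> 3/2"
    by (simp add: suminf_geometric)
qed

lemma cantor_code_shift: "cantor_code b = of_bool (b 0) + cantor_code (\<lambda>i. b (Suc i)) / 3"
  using suminf_split_head[OF cantor_code_summable[of b]]
    suminf_divide[OF cantor_code_summable[of "\<lambda>i. b (Suc i)"], of 3]
  by (simp add: cantor_code_def mult.commute)

text \<open>The digits after the first contribute at most 1/2 in total, so unequal first digits put
  codes at least 1/2 apart. Deleting a common first digit multiplies the difference by 3, which
  drives the induction.\<close>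

lemma cantor_code_close:
  assumes "\<bar>cantor_code b - cantor_code c\<bar> < 1 / (2 * 3 ^ n)" and "i \<le> n"
  shows "b i = c i"
  using assms
proof (induction n arbitrary: b c i)
  case 0
  then show ?case
    using cantor_code_shift[of b] cantor_code_shift[of c]
      cantor_code_bounds[of "\<lambda>i. b (Suc i)"] cantor_code_bounds[of "\<lambda>i. c (Suc i)"]
    by (cases "b 0"; cases "c 0") auto
next
  case (Suc n)
  have "1 / (2 * 3 ^ Suc n) \<le> (1/2 :: real)"
    using one_le_power[of "3::real" "Suc n"] by (simp add: field_simps)
  then have "\<bar>cantor_code b - cantor_code c\<bar> < 1/2"
    using Suc.prems(1) by linarith
  then have b0: "b 0 = c 0"
    using cantor_code_shift[of b] cantor_code_shift[of c]
      cantor_code_bounds[of "\<lambda>i. b (Suc i)"] cantor_code_bounds[of "\<lambda>i. c (Suc i)"]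
    by (cases "b 0"; cases "c 0") auto
  show ?case
  proof (cases i)
    case 0
    then show ?thesis using b0 by simp
  next
    case (Suc j)
    have "cantor_code (\<lambda>i. b (Suc i)) - cantor_code (\<lambda>i. c (Suc i)) =
        3 * (cantor_code b - cantor_code c)"
      using b0 cantor_code_shift[of b] cantor_code_shift[of c] by simp
    then have "\<bar>cantor_code (\<lambda>i. b (Suc i)) - cantor_code (\<lambda>i. c (Suc i))\<bar> =
        3 * \<bar>cantor_code b - cantor_code c\<bar>"
      by (simp only: abs_mult abs_numeral)
    then have "\<bar>cantor_code (\<lambda>i. b (Suc i)) - cantor_code (\<lambda>i. c (Suc i))\<bar> < 1 / (2 * 3 ^ n)"
      using Suc.prems(1) by (simp add: field_simps)
    then show ?thesis
      using Suc.IH[of "\<lambda>i. b (Suc i)" "\<lambda>i. c (Suc i)" j] Suc.prems(2) Suc by simp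
  qed
qed

text \<open>The i-th ternary digit records whether the set meets the i-th basic open set.\<close>
lemma compact_set_code:
  fixes B :: "'a::euclidean_space set"
  assumes "compact B"
  obtains code :: "'a set \<Rightarrow> real" where
    "\<And>K. 0 \<le> code K \<and> code K \<le> 3/2"
    "\<And>K \<epsilon>. compact K \<Longrightarrow> \<epsilon> > 0 \<Longrightarrow>
       \<exists>\<delta>>0. \<forall>K'\<subseteq>B. \<bar>code K' - code K\<bar> < \<delta> \<longrightarrow> (\<forall>z\<in>K'. \<exists>w\<in>K. dist z w < \<epsilon>)"
proof -
  obtain V :: "nat \<Rightarrow> 'a set" where "inj V" and V: "\<And>n. open (V n)"
      and base: "\<And>S. open S \<Longrightarrow> \<exists>k. S = \<Union>{V n |n. n \<in> k}"
    by (rule univ_second_countable_sequence) blast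
  define code where "code K = cantor_code (\<lambda>i. K \<inter> V i \<noteq> {})" for K
  show ?thesis
  proof (rule that[of code])
    fix K :: "'a set" and \<epsilon> :: real
    assume K: "compact K" and \<epsilon>: "\<epsilon> > 0"
    \<comment> \<open>The part of \<open>B\<close> away from \<open>K\<close> is compact and covered
      by basic open sets missing \<open>K\<close>, of which finitely many suffice. A set
      \<open>K'\<close> sharing these digits with \<open>K\<close> misses them too, hence misses
      \<open>C\<close>.\<close>
    define C where "C = B - (\<Union>w\<in>K. ball w \<epsilon>)"
    have "compact C"
      unfolding C_def using assms by (intro compact_diff open_UN) auto
    moreover have "C \<subseteq> \<Union>(V ` {i. K \<inter> V i = {}})"
    proof
      fix z assume z: "z \<in> C"
      then have "z \<notin> K" using \<epsilon> by (auto simp: C_def)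
      moreover obtain k where k: "- K = \<Union>{V n |n. n \<in> k}"
        using base[of "- K"] K by (auto simp: compact_imp_closed open_Compl)
      ultimately obtain n where "n \<in> k" "z \<in> V n" by auto
      moreover from k \<open>n \<in> k\<close> have "V n \<subseteq> - K" by auto
      ultimately show "z \<in> \<Union>(V ` {i. K \<inter> V i = {}})" by auto
    qed
    ultimately obtain I where I: "I \<subseteq> {i. K \<inter> V i = {}}" "finite I" "C \<subseteq> \<Union>(V ` I)"
      using V by (metis compactE_image)
    obtain n where n: "\<And>i. i \<in> I \<Longrightarrow> i \<le> n"
      using I(2) finite_nat_set_iff_bounded_le by auto
    show "\<exists>\<delta>>0. \<forall>K'\<subseteq>B. \<bar>code K' - code K\<bar> < \<delta> \<longrightarrow> (\<forall>z\<in>K'. \<exists>w\<in>K. dist z w < \<epsilon>)"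
    proof (intro exI[of _ "1 / (2 * 3 ^ n)"] conjI allI impI ballI)
      fix K' z assume K': "K' \<subseteq> B" "\<bar>code K' - code K\<bar> < 1 / (2 * 3 ^ n)" and z: "z \<in> K'"
      have "z \<notin> C"
      proof
        assume "z \<in> C"
        then obtain i where i: "i \<in> I" "z \<in> V i" using I(3) by auto
        have "(K' \<inter> V i \<noteq> {}) = (K \<inter> V i \<noteq> {})"
          using cantor_code_close[OF K'(2)[unfolded code_def] n[OF i(1)]] .
        then show False using i z I(1) by auto
      qed
      then show "\<exists>w\<in>K. dist z w < \<epsilon>"
        using z K'(1) by (auto simp: C_def dist_commute)
    qed auto
  qed (unfold code_def, blast intro: cantor_code_bounds)
qed

section \<open>Step functions and cutoffs of linear functions\<close>

lemma DERIV_max_0_squared: "((\<lambda>u::real. (max 0 u)\<^sup>2) has_real_derivative 2 * max 0 u) (at u)"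
proof -
  consider "u > 0" | "u < 0" | "u = 0" by linarith
  then show ?thesis
  proof cases
    case 1
    have "((\<lambda>u. u\<^sup>2) has_real_derivative 2 * max 0 u) (at u)"
      using 1 by (auto intro!: derivative_eq_intros)
    then show ?thesis
      by (rule has_field_derivative_transform_within_open[where S = "{0<..}"]) (use 1 in auto)
  next
    case 2
    have "((\<lambda>u. 0) has_real_derivative 2 * max 0 u) (at u)"
      using 2 by (auto intro!: derivative_eq_intros)
    then show ?thesis
      by (rule has_field_derivative_transform_within_open[where S = "{..<0}"]) (use 2 in auto)
  next
    case 3
    have "((\<lambda>h::real. (max 0 h)\<^sup>2 / h) \<longlongrightarrow> 0) (at 0)"
    proof (rule tendsto_0_le[where K = 1 and f = "\<lambda>h. h"])
      show "\<forall>\<^sub>F h::real in at 0. norm ((max 0 h)\<^sup>2 / h) \<le> norm h * 1"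
        by (intro always_eventually) (auto simp: max_def power2_eq_square)
    qed (rule tendsto_ident_at)
    then show ?thesis
      using 3 by (simp add: DERIV_def)
  qed
qed

text \<open>Squared positive parts are differentiable across the kink, so using them twice flattens
  both ends: \<open>v\<close> is 1 up to -1 and nonpositive from 0 on, and squaring its positive
  part removes the corner at 0. The constant 4 is 2 * 1 * 2, from \<open>v \<le> 1\<close> and
  \<open>\<bar>v'\<bar> \<le> 2\<close> on the negative axis.\<close>

lemma C1_step_function:
  obtains \<theta> \<theta>' :: "real \<Rightarrow> real" where
    "\<And>u. (\<theta> has_real_derivative \<theta>' u) (at u)"
    "\<And>u. 0 \<le> \<theta> u \<and> \<theta> u \<le> 1"
    "\<And>u. u \<le> -1 \<Longrightarrow> \<theta> u = 1 \<and> \<theta>' u = 0"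
    "\<And>u. 0 \<le> u \<Longrightarrow> \<theta> u = 0 \<and> \<theta>' u = 0"
    "\<And>u. \<bar>\<theta>' u\<bar> \<le> 4"
proof -
  define v where "v u = 1 - (max 0 (1 + u))\<^sup>2" for u :: real
  define v' where "v' u = - (2 * max 0 (1 + u))" for u :: real
  have v: "(v has_real_derivative v' u) (at u)" for u
  proof -
    have "((\<lambda>u. 1 + u) has_real_derivative 1) (at u)"
      by (auto intro!: derivative_eq_intros)
    from DERIV_diff[OF DERIV_const DERIV_chain2[OF DERIV_max_0_squared this], of 1] show ?thesis
      unfolding v_def v'_def by simp
  qed
  have v_le: "v u \<le> 1" for u
    by (simp add: v_def)
  have v_nonpos: "v u \<le> 0" if "0 \<le> u" for u
    using that one_le_power[of "1 + u" 2] by (simp add: v_def max_def)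
  show thesis
  proof (rule that[of "\<lambda>u. (max 0 (v u))\<^sup>2" "\<lambda>u. 2 * max 0 (v u) * v' u"])
    fix u :: real
    show "((\<lambda>u. (max 0 (v u))\<^sup>2) has_real_derivative 2 * max 0 (v u) * v' u) (at u)"
      using DERIV_chain2[OF DERIV_max_0_squared v] .
    show "0 \<le> (max 0 (v u))\<^sup>2 \<and> (max 0 (v u))\<^sup>2 \<le> 1"
      using v_le[of u] by (auto intro!: power_le_one)
    show "(max 0 (v u))\<^sup>2 = 1 \<and> 2 * max 0 (v u) * v' u = 0" if "u \<le> -1"
      using that by (simp add: v_def v'_def)
    show "(max 0 (v u))\<^sup>2 = 0 \<and> 2 * max 0 (v u) * v' u = 0" if "0 \<le> u"
      using v_nonpos[OF that] by (simp add: max_def)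
    show "\<bar>2 * max 0 (v u) * v' u\<bar> \<le> 4"
    proof (cases "0 \<le> u")
      case True
      then show ?thesis using v_nonpos[OF True] by (simp add: max_def)
    next
      case False
      then have "\<bar>v' u\<bar> \<le> 2" by (auto simp: v'_def)
      then have "\<bar>max 0 (v u)\<bar> * \<bar>v' u\<bar> \<le> 1 * 2"
        using v_le[of u] by (intro mult_mono) auto
      then show ?thesis by (simp add: abs_mult mult.commute)
    qed
  qed
qed

text \<open>
  The cutoff varies in ln |x|, so that its gradient is at most a small multiple of 1 / |x| and
  multiplication by the linear function \<open>x \<mapsto> q \<bullet> x\<close> perturbs the gradients in the segment from 0
  to q only slightly.
\<close>
lemma cutoff_linear:
  fixes P :: "'a::euclidean_space set"
  assumes P: "convex P" "0 \<in> interior P" "q \<in> interior P"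
  obtains \<phi> G \<rho> where
    "\<And>x. GDERIV \<phi> x :> G x"
    "\<And>x. G x \<in> P"
    "\<And>x. 1 \<le> norm x \<Longrightarrow> \<phi> x = 0 \<and> G x = 0"
    "\<And>x. \<bar>\<phi> x\<bar> \<le> norm q"
    "0 < \<rho>" "\<rho> \<le> 1"
    "\<And>x. x \<in> ball 0 \<rho> \<Longrightarrow> \<phi> x = q \<bullet> x \<and> G x = q"
proof -
  obtain \<theta> \<theta>' :: "real \<Rightarrow> real" where
    \<theta>: "\<And>u. (\<theta> has_real_derivative \<theta>' u) (at u)" and
    \<theta>_bounds: "\<And>u. 0 \<le> \<theta> u \<and> \<theta> u \<le> 1" and
    \<theta>_one: "\<And>u. u \<le> -1 \<Longrightarrow> \<theta> u = 1 \<and> \<theta>' u = 0" and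
    \<theta>_zero: "\<And>u. 0 \<le> u \<Longrightarrow> \<theta> u = 0 \<and> \<theta>' u = 0" and
    \<theta>'_le: "\<And>u. \<bar>\<theta>' u\<bar> \<le> 4"
    using C1_step_function by blast
  obtain \<delta>\<^sub>0 where \<delta>\<^sub>0: "\<delta>\<^sub>0 > 0" "cball 0 \<delta>\<^sub>0 \<subseteq> P"
    using P(2) mem_interior_cball by blast
  obtain \<delta>\<^sub>1 where \<delta>\<^sub>1: "\<delta>\<^sub>1 > 0" "cball q \<delta>\<^sub>1 \<subseteq> P"
    using P(3) mem_interior_cball by blast
  define \<delta> where "\<delta> = min \<delta>\<^sub>0 \<delta>\<^sub>1"
  \<comment> \<open>Makes the error term \<open>E\<close>, bounded by
    \<open>2 * \<epsilon> * 4 * norm q\<close>, at most \<open>\<delta>\<close>; the summand 1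
    avoids division by 0 for \<open>q = 0\<close>.\<close>
  define \<epsilon> where "\<epsilon> = \<delta> / (8 * norm q + 1)"
  have "\<delta> > 0" using \<delta>\<^sub>0 \<delta>\<^sub>1 by (simp add: \<delta>_def)
  then have \<epsilon>: "\<epsilon> > 0" by (simp add: \<epsilon>_def add_nonneg_pos)
  have "\<epsilon> * (8 * norm q + 1) = \<delta>"
    unfolding \<epsilon>_def using norm_ge_zero[of q] by (intro nonzero_eq_divide_eq[THEN iffD1]) linarith+
  then have \<epsilon>\<delta>: "8 * \<epsilon> * norm q \<le> \<delta>"
    using \<epsilon> by (simp add: algebra_simps)
  define u where "u x = \<epsilon> * ln (x \<bullet> x)" for x :: 'a
  define \<phi> where "\<phi> x = \<theta> (u x) * (q \<bullet> x)" for x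
  \<comment> \<open>\<open>E\<close> comes from differentiating the cutoff factor. At 0, where the
    logarithm has no useful value, \<open>G\<close> is set by hand to the gradient of the linear
    function.\<close>
  define E where "E x = (2 * \<epsilon> * \<theta>' (u x) * (q \<bullet> x) / (x \<bullet> x)) *\<^sub>R x" for x
  define G where "G x = (if x = 0 then q else \<theta> (u x) *\<^sub>R q + E x)" for x
  \<comment> \<open>For nonzero \<open>x\<close>, \<open>u x = 2 * \<epsilon> * ln (norm x)\<close>,
    so this is the radius at which \<open>u\<close> reaches -1, where the cutoff becomes 1.\<close>
  define \<rho> where "\<rho> = exp (- 1 / (2 * \<epsilon>))"
  have \<rho>: "0 < \<rho>" "\<rho> \<le> 1" using \<epsilon> by (auto simp: \<rho>_def)
  have u_small: "u x \<le> -1" if "x \<in> ball 0 \<rho>" "x \<noteq> 0" for x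
  proof -
    have "ln (norm x) \<le> ln \<rho>"
      using that \<rho> by (intro ln_mono) auto
    then have "ln (norm x) \<le> - 1 / (2 * \<epsilon>)"
      by (simp add: \<rho>_def)
    moreover have "ln (x \<bullet> x) = 2 * ln (norm x)"
      using that by (simp add: dot_square_norm ln_realpow)
    ultimately show ?thesis
      using \<epsilon> by (simp add: u_def field_simps)
  qed
  have \<phi>_near: "\<phi> x = q \<bullet> x \<and> G x = q" if "x \<in> ball 0 \<rho>" for x
    using \<theta>_one[OF u_small[OF that]] by (cases "x = 0") (auto simp: \<phi>_def G_def E_def)
  have E_le: "norm (E x) \<le> \<delta>" if "x \<noteq> 0" for x
  proof -
    have "norm (E x) = 2 * \<epsilon> * \<bar>\<theta>' (u x)\<bar> * (\<bar>q \<bullet> x\<bar> / norm x)"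
      using \<epsilon> that by (simp add: E_def abs_mult dot_square_norm power2_eq_square)
    also have "\<dots> \<le> 2 * \<epsilon> * 4 * norm q"
    proof (intro mult_mono)
      show "\<bar>q \<bullet> x\<bar> / norm x \<le> norm q"
        using that Cauchy_Schwarz_ineq2[of q x] by (simp add: pos_divide_le_eq)
    qed (use \<epsilon> \<theta>'_le in auto)
    finally show ?thesis using \<epsilon>\<delta> by simp
  qed
  have deriv: "GDERIV \<phi> x :> G x" for x
  proof (cases "x = 0")
    case True
    have "GDERIV (\<lambda>x. q \<bullet> x) x :> q"
      unfolding gderiv_def by (auto intro!: derivative_eq_intros simp: inner_commute)
    then have "GDERIV \<phi> x :> q"
      by (rule GDERIV_transform_open[where S = "ball 0 \<rho>"]) (use True \<rho> \<phi>_near in auto)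
    then show ?thesis by (simp add: G_def True)
  next
    case False
    then have "x \<bullet> x > 0" by simp
    then have "(u has_derivative (\<lambda>h. \<epsilon> * (2 * (x \<bullet> h) / (x \<bullet> x)))) (at x)"
      unfolding u_def by (auto intro!: derivative_eq_intros simp: inner_commute field_simps)
    from has_derivative_compose[OF this \<theta>[unfolded has_field_derivative_def]]
    have "((\<lambda>x. \<theta> (u x)) has_derivative (\<lambda>h. \<theta>' (u x) * (\<epsilon> * (2 * (x \<bullet> h) / (x \<bullet> x))))) (at x)" .
    moreover have "((\<lambda>x. q \<bullet> x) has_derivative (\<lambda>h. q \<bullet> h)) (at x)"
      by (auto intro!: derivative_eq_intros)
    ultimately have "(\<phi> has_derivative (\<lambda>h. \<theta> (u x) * (q \<bullet> h) +
        \<theta>' (u x) * (\<epsilon> * (2 * (x \<bullet> h) / (x \<bullet> x))) * (q \<bullet> x))) (at x)"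
      unfolding \<phi>_def by (rule has_derivative_mult)
    moreover have "\<theta> (u x) * (q \<bullet> h) + \<theta>' (u x) * (\<epsilon> * (2 * (x \<bullet> h) / (x \<bullet> x))) * (q \<bullet> x)
        = h \<bullet> G x" for h
      using False by (simp add: G_def E_def inner_add_right inner_commute)
    ultimately show ?thesis by (simp add: gderiv_def)
  qed
  have G_in: "G x \<in> P" for x
  proof (cases "x = 0")
    case True
    then show ?thesis using P(3) interior_subset by (auto simp: G_def)
  next
    case False
    \<comment> \<open>\<open>G x\<close> is a convex combination of these two points, which are
      within \<open>\<delta>\<close> of the interior points 0 and \<open>q\<close>.\<close>
    have "E x \<in> P" "q + E x \<in> P"
      using E_le[OF False] \<delta>\<^sub>0(2) \<delta>\<^sub>1(2) by (auto simp: \<delta>_def dist_norm subset_iff)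
    then have "(1 - \<theta> (u x)) *\<^sub>R E x + \<theta> (u x) *\<^sub>R (q + E x) \<in> P"
      using \<theta>_bounds[of "u x"] by (intro convexD[OF P(1)]) auto
    then show ?thesis using False by (simp add: G_def algebra_simps)
  qed
  have supp: "\<phi> x = 0 \<and> G x = 0" if "1 \<le> norm x" for x
  proof -
    have "u x \<ge> 0"
      using \<epsilon> that one_le_power[OF that, of 2] by (simp add: u_def dot_square_norm)
    then show ?thesis
      using \<theta>_zero[of "u x"] that by (auto simp: \<phi>_def G_def E_def)
  qed
  have "\<bar>\<phi> x\<bar> \<le> norm q" for x
  proof (cases "1 \<le> norm x")
    case False
    have "\<bar>q \<bullet> x\<bar> \<le> norm q * 1"
      using Cauchy_Schwarz_ineq2[of q x] False mult_left_mono[of "norm x" 1 "norm q"] by simp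
    moreover have "\<bar>\<phi> x\<bar> \<le> 1 * \<bar>q \<bullet> x\<bar>"
      unfolding \<phi>_def abs_mult using \<theta>_bounds[of "u x"] by (intro mult_right_mono) auto
    ultimately show ?thesis by simp
  qed (use supp in simp)
  with that[OF deriv G_in supp _ \<rho> \<phi>_near] show thesis by blast
qed

section \<open>Gluing disjoint bumps\<close>

text \<open>Handles the hyperplane towards which the bumps shrink, where their sum need not be
  locally finite.\<close>

lemma GDERIV_zero_if_quadratic_bound:
  fixes f :: "'a::real_inner \<Rightarrow> real"
  assumes "f x = 0" "\<And>y. \<bar>f y\<bar> \<le> M * (norm (y - x))\<^sup>2"
  shows "GDERIV f x :> 0"
  unfolding gderiv_def
proof (rule has_derivativeI_sandwich[where e = 1 and H = "\<lambda>y. M * norm (y - x)"])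
  show "((\<lambda>y. M * norm (y - x)) \<longlongrightarrow> 0) (at x)"
    by (auto intro!: tendsto_eq_intros)
  show "norm (f y - f x - (y - x) \<bullet> 0) / norm (y - x) \<le> M * norm (y - x)" if "y \<noteq> x" for y
    using that assms(1) assms(2)[of y] by (simp add: pos_divide_le_eq power2_eq_square mult.assoc)
qed (auto simp: bounded_linear_zero)

text \<open>
  The bumps have centres \<open>t k *\<^sub>R e1 + (1/2)^k *\<^sub>R e2\<close> and radii \<open>(1/4)^k / 8\<close>, so their sum is bounded by
  a multiple of the squared distance to the hyperplane orthogonal to e2.
\<close>
lemma glue_bumps:
  fixes e1 e2 :: "'a::euclidean_space" and \<phi> :: "nat \<Rightarrow> 'a \<Rightarrow> real"
  assumes e: "norm e1 = 1" "norm e2 = 1" "e1 \<bullet> e2 = 0"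
    and t: "\<And>k. \<bar>t k\<bar> \<le> 2"
    and \<phi>: "\<And>k x. GDERIV (\<phi> k) x :> G k x"
    and supp: "\<And>k. \<forall>x. 1 \<le> norm x \<longrightarrow> \<phi> k x = 0 \<and> G k x = 0"
    and M: "\<And>k x. \<bar>\<phi> k x\<bar> \<le> M"
  obtains r a h H where
    "\<And>k. 0 < r k \<and> r k \<le> (1/2) ^ k"
    "\<And>k. dist (a k) (t k *\<^sub>R e1) \<le> (1/2) ^ k"
    "\<And>k x. x \<in> ball (a k) (r k) \<Longrightarrow> \<bar>x \<bullet> e1 - t k\<bar> \<le> x \<bullet> e2"
    "\<And>x. GDERIV h x :> H x"
    "\<And>k x. x \<in> ball (a k) (r k) \<Longrightarrow> H x = G k ((x - a k) /\<^sub>R r k)"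
    "\<And>x. (\<And>k. x \<notin> ball (a k) (r k)) \<Longrightarrow> H x = 0"
    "\<And>x. 4 \<le> norm x \<Longrightarrow> h x = 0 \<and> H x = 0"
proof -
  define w :: "nat \<Rightarrow> real" where "w k = (1/2) ^ k" for k
  define r where "r k = (w k)\<^sup>2 / 8" for k
  define a where "a k = t k *\<^sub>R e1 + w k *\<^sub>R e2" for k
  \<comment> \<open>The balls will be disjoint, so this is the index of the only ball containing
    \<open>x\<close>. Outside all balls the index is arbitrary, which is harmless because every bump
    vanishes there.\<close>
  define \<kappa> where "\<kappa> x = (SOME k. x \<in> ball (a k) (r k))" for x
  define g where "g k x = r k * \<phi> k ((x - a k) /\<^sub>R r k)" for k x
  define G' where "G' k x = G k ((x - a k) /\<^sub>R r k)" for k x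
  define h where "h x = g (\<kappa> x) x" for x
  define H where "H x = G' (\<kappa> x) x" for x
  have ee: "e1 \<bullet> e1 = 1" "e2 \<bullet> e2 = 1" "e2 \<bullet> e1 = 0"
    using e by (simp_all add: dot_square_norm inner_commute)
  have w: "0 < w k" "w k \<le> 1" for k
    by (auto simp: w_def power_le_one)
  have w_mono: "w k \<le> w j / 2" if "j < k" for j k
    using power_decreasing[of "Suc j" k "1/2::real"] that by (simp add: w_def)
  have r: "0 < r k" "r k \<le> w k / 8" for k
    using w[of k] mult_left_mono[of "w k" 1 "w k"] by (auto simp: r_def power2_eq_square)
  have in_ball: "\<bar>x \<bullet> e1 - t k\<bar> < r k" "\<bar>x \<bullet> e2 - w k\<bar> < r k" if "x \<in> ball (a k) (r k)" for x k
  proof -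
    have "norm (x - a k) < r k"
      using that by (simp add: dist_norm norm_minus_commute)
    then show "\<bar>x \<bullet> e1 - t k\<bar> < r k" "\<bar>x \<bullet> e2 - w k\<bar> < r k"
      using Cauchy_Schwarz_ineq2[of "x - a k" e1] Cauchy_Schwarz_ineq2[of "x - a k" e2] e ee
      by (simp_all add: a_def inner_diff_left inner_add_left)
  qed
  \<comment> \<open>In direction \<open>e2\<close>, ball \<open>k\<close> lies between 7/8 and 9/8
    of \<open>w k\<close>; since the heights halve from one index to the next, these intervals are
    disjoint.\<close>
  have disjoint: "\<not> j < k" if "x \<in> ball (a j) (r j)" "x \<in> ball (a k) (r k)" for x j k
    using in_ball(2)[OF that(1)] in_ball(2)[OF that(2)] r(2)[of j] r(2)[of k] w[of j] w_mono[of j k]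
    by (auto simp: abs_less_iff)
  have \<kappa>: "\<kappa> x = k" if "x \<in> ball (a k) (r k)" for x k
    unfolding \<kappa>_def using that disjoint by (intro some_equality) (auto, metis linorder_neqE_nat)
  have outside: "g k x = 0 \<and> G' k x = 0" if "x \<notin> ball (a k) (r k)" for x k
  proof -
    have "norm ((x - a k) /\<^sub>R r k) = dist (a k) x / r k"
      using r(1)[of k] by (simp add: dist_norm norm_minus_commute divide_inverse_commute)
    then have "1 \<le> norm ((x - a k) /\<^sub>R r k)"
      using that r(1)[of k] by (simp add: pos_le_divide_eq)
    then show ?thesis using supp by (simp add: g_def G'_def)
  qed
  have g: "GDERIV (g k) x :> G' k x" for k x
    unfolding g_def G'_def by (intro GDERIV_rescale \<phi> r)
  \<comment> \<open>At distance more than \<open>2 * w n\<close> from the hyperplane only bumps with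
    index below \<open>n\<close> occur, so off the hyperplane the sum is locally finite.\<close>
  have local_sum: "h x = (\<Sum>k<n. g k x) \<and> H x = (\<Sum>k<n. G' k x)" if "2 * w n < \<bar>x \<bullet> e2\<bar>" for n x
  proof (cases "\<exists>k. x \<in> ball (a k) (r k)")
    case True
    then obtain k where k: "x \<in> ball (a k) (r k)" by auto
    have "\<not> n \<le> k"
    proof
      assume "n \<le> k"
      then have "w k \<le> w n" by (simp add: w_def power_decreasing)
      then show False using in_ball(2)[OF k] r(2)[of k] w[of k] that by auto
    qed
    moreover have "g j x = 0 \<and> G' j x = 0" if "j \<noteq> k" for j
      using outside[of x j] \<kappa>[OF k] \<kappa>[of x j] that by metis
    ultimately have "(\<Sum>j<n. g j x) = (\<Sum>j\<in>{k}. g j x)" "(\<Sum>j<n. G' j x) = (\<Sum>j\<in>{k}. G' j x)"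
      by (intro sum.mono_neutral_right; auto)+
    then show ?thesis using \<kappa>[OF k] by (simp add: h_def H_def)
  next
    case False
    then show ?thesis using outside by (simp add: h_def H_def)
  qed
  have "M \<ge> 0" using M[of 0 0] by linarith
  \<comment> \<open>Inside ball \<open>k\<close> the height is at least \<open>w k / 2\<close>,
    while the bump is at most \<open>M * r k\<close>, and \<open>r k\<close> is quadratic in
    \<open>w k\<close>.\<close>
  have h_le: "\<bar>h y\<bar> \<le> M * (y \<bullet> e2)\<^sup>2" for y
  proof (cases "y \<in> ball (a (\<kappa> y)) (r (\<kappa> y))")
    case True
    let ?k = "\<kappa> y"
    have "w ?k / 2 \<le> y \<bullet> e2"
      using in_ball(2)[OF True] r(2)[of ?k] by auto
    then have "(w ?k / 2)\<^sup>2 \<le> (y \<bullet> e2)\<^sup>2"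
      using w[of ?k] by (intro power_mono) auto
    moreover have "r ?k \<le> (w ?k / 2)\<^sup>2"
      by (simp add: r_def power_divide)
    ultimately have "r ?k \<le> (y \<bullet> e2)\<^sup>2"
      by simp
    then have "r ?k * \<bar>\<phi> ?k ((y - a ?k) /\<^sub>R r ?k)\<bar> \<le> (y \<bullet> e2)\<^sup>2 * M"
      using M r(1)[of ?k] \<open>M \<ge> 0\<close> by (intro mult_mono) auto
    then show ?thesis
      using r(1)[of ?k] by (simp add: h_def g_def abs_mult mult.commute)
  next
    case False
    then show ?thesis using outside \<open>M \<ge> 0\<close> by (simp add: h_def)
  qed
  have deriv: "GDERIV h x :> H x" for x
  proof (cases "x \<bullet> e2 = 0")
    case True
    have "x \<notin> ball (a k) (r k)" for k
      using in_ball(2)[of x k] r(2)[of k] w[of k] True by auto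
    then have "H x = 0" "h x = 0"
      using outside by (auto simp: H_def h_def)
    moreover have "\<bar>h y\<bar> \<le> M * (norm (y - x))\<^sup>2" for y
    proof -
      have "\<bar>y \<bullet> e2\<bar> \<le> norm (y - x)"
        using Cauchy_Schwarz_ineq2[of "y - x" e2] e True by (simp add: inner_diff_left)
      then have "(y \<bullet> e2)\<^sup>2 \<le> (norm (y - x))\<^sup>2"
        by (metis abs_le_square_iff abs_norm_cancel)
      then show ?thesis
        using h_le[of y] mult_left_mono[OF _ \<open>M \<ge> 0\<close>] by (meson order_trans)
    qed
    ultimately show ?thesis
      using GDERIV_zero_if_quadratic_bound by metis
  next
    case False
    then obtain n where n: "2 * w n < \<bar>x \<bullet> e2\<bar>"
      using real_arch_pow_inv[of "\<bar>x \<bullet> e2\<bar> / 2" "1/2"] by (auto simp: w_def mult.commute)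
    define S where "S = {y. 2 * w n < \<bar>y \<bullet> e2\<bar>}"
    have "open S"
      unfolding S_def by (intro open_Collect_less continuous_intros)
    moreover have "GDERIV (\<lambda>y. \<Sum>k<n. g k y) x :> (\<Sum>k<n. G' k x)"
      using g unfolding gderiv_def inner_sum_right by (intro has_derivative_sum) auto
    ultimately show ?thesis
      using n local_sum GDERIV_transform_open[of "\<lambda>y. \<Sum>k<n. g k y" x "\<Sum>k<n. G' k x" S h]
      by (simp add: S_def)
  qed
  show thesis
  proof (rule that[of r a h H])
    show "0 < r k \<and> r k \<le> (1/2) ^ k" for k
      using r[of k] w[of k] by (simp add: w_def)
    show "dist (a k) (t k *\<^sub>R e1) \<le> (1/2) ^ k" for k
      using e by (simp add: a_def w_def dist_norm)
    \<comment> \<open>The offset along \<open>e1\<close> is below \<open>w k / 8\<close> and the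
      height above \<open>7/8 * w k\<close>. Thus a small height forces the first coordinate to be
      close to \<open>t k\<close>.\<close>
    show "\<bar>x \<bullet> e1 - t k\<bar> \<le> x \<bullet> e2" if "x \<in> ball (a k) (r k)" for k x
      using in_ball[OF that] r(2)[of k] w[of k] by linarith
    show "GDERIV h x :> H x" for x by (rule deriv)
    show "H x = G k ((x - a k) /\<^sub>R r k)" if "x \<in> ball (a k) (r k)" for k x
      using \<kappa>[OF that] by (simp add: H_def G'_def)
    show "H x = 0" if "\<And>k. x \<notin> ball (a k) (r k)" for x
      using outside that by (simp add: H_def)
    show "h x = 0 \<and> H x = 0" if "4 \<le> norm x" for x
    proof -
      have "x \<notin> ball (a k) (r k)" for k
      proof
        assume "x \<in> ball (a k) (r k)"
        then have "norm x < norm (a k) + r k"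
          using norm_triangle_ineq2[of x "a k"] by (simp add: dist_norm norm_minus_commute)
        moreover have "norm (a k) \<le> \<bar>t k\<bar> + w k"
          unfolding a_def using norm_triangle_ineq[of "t k *\<^sub>R e1" "w k *\<^sub>R e2"] e w[of k] by simp
        ultimately show False
          using t[of k] w[of k] r(2)[of k] that by linarith
      qed
      then show ?thesis using outside by (simp add: h_def H_def)
    qed
  qed
qed

section \<open>Bodies with a prescribed interior point\<close>

text \<open>Near the origin the gradient between the bumps is \<open>p\<close>, which is admissible
  because \<open>p\<close> lies in every body considered. Body \<open>K\<close> is attained at a
  fixed multiple of \<open>code K *\<^sub>R e1\<close>.\<close>

lemma realizer_with_interior_point:
  fixes p e1 e2 :: "'a::euclidean_space"
  assumes e: "norm e1 = 1" "norm e2 = 1" "e1 \<bullet> e2 = 0" and p: "norm p < 1"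
  obtains f F where
    "\<And>x. GDERIV f x :> F x"
    "\<And>x. norm (F x) \<le> 1"
    "\<And>x. 1 \<le> norm x \<Longrightarrow> f x = 0 \<and> F x = 0"
    "\<And>K. convex_body K \<Longrightarrow> K \<subseteq> cball 0 1 \<Longrightarrow> p \<in> interior K \<Longrightarrow> \<exists>x\<in>ball 0 1. realizes F K x"
proof -
  obtain code :: "'a set \<Rightarrow> real" where
    code_bounds: "\<And>K. 0 \<le> code K \<and> code K \<le> 3/2" and
    code_close: "\<And>K \<epsilon>. compact K \<Longrightarrow> \<epsilon> > 0 \<Longrightarrow> \<exists>\<delta>>0. \<forall>K'\<subseteq>cball 0 1.
        \<bar>code K' - code K\<bar> < \<delta> \<longrightarrow> (\<forall>z\<in>K'. \<exists>w\<in>K. dist z w < \<epsilon>)"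
    by (fact compact_set_code[OF compact_cball])
  define \<K> where "\<K> = {K. convex_body K \<and> K \<subseteq> cball 0 1 \<and> p \<in> interior K}"
  \<comment> \<open>Separability of this set of pairs reduces the uncountable family of bodies to
    countably many bumps.\<close>
  define T where "T = {(code K, q) | K q. K \<in> \<K> \<and> q \<in> interior K}"
  obtain D where D: "countable D" "D \<subseteq> T" "T \<subseteq> closure D"
    using separable[of T] by blast
  have "cball 0 1 \<in> \<K>"
    using p by (auto simp: \<K>_def convex_body_def)
  then have "(code (cball 0 1), p) \<in> T"
    using p by (auto simp: T_def)
  then have "D \<noteq> {}" using D(3) by auto
  \<comment> \<open>Enumerate D so that every element occurs at arbitrarily large indices.\<close>
  define d where "d k = from_nat_into D (fst (prod_decode k))" for k
  define t where "t k = fst (d k)" for k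
  define q where "q k = snd (d k)" for k
  have "\<exists>K. K \<in> \<K> \<and> q k \<in> interior K \<and> code K = t k" for k
  proof -
    have "d k \<in> T"
      using from_nat_into[OF \<open>D \<noteq> {}\<close>] D(2) unfolding d_def by blast
    then show ?thesis unfolding T_def t_def q_def by auto
  qed
  then obtain L where L: "\<And>k. L k \<in> \<K>" "\<And>k. q k \<in> interior (L k)" "\<And>k. code (L k) = t k"
    by metis
  have L_sub: "L k \<subseteq> cball 0 1" for k
    using L(1) by (simp add: \<K>_def)
  \<comment> \<open>Subtracting \<open>p\<close> puts 0 into the interior of the body, as the cutoff
    requires; the background gradient \<open>p\<close> later moves the gradients back into
    \<open>L k\<close>.\<close>
  have "\<exists>\<phi> G \<rho>. (\<forall>x. GDERIV \<phi> x :> G x) \<and> (\<forall>x. G x \<in> (\<lambda>z. z - p) ` L k) \<and>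
      (\<forall>x. 1 \<le> norm x \<longrightarrow> \<phi> x = 0 \<and> G x = 0) \<and> (\<forall>x. \<bar>\<phi> x\<bar> \<le> 2) \<and>
      0 < \<rho> \<and> \<rho> \<le> 1 \<and> (\<forall>x\<in>ball 0 \<rho>. G x = q k - p)" for k
  proof -
    have conv: "convex ((\<lambda>z. z - p) ` L k)"
      using L(1)[of k] by (simp add: \<K>_def convex_body_def)
    have int0: "0 \<in> interior ((\<lambda>z. z - p) ` L k)"
      using L(1)[of k] by (force simp: \<K>_def interior_translation_subtract)
    have intq: "q k - p \<in> interior ((\<lambda>z. z - p) ` L k)"
      using L(2)[of k] by (simp add: interior_translation_subtract)
    have q_le: "norm (q k - p) \<le> 2"
    proof -
      have "norm (q k) \<le> 1"
        using L(2)[of k] L_sub[of k] interior_subset by (force simp: subset_iff)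
      then show ?thesis using p norm_triangle_ineq4[of "q k" p] by linarith
    qed
    obtain \<phi> G \<rho> where *: "\<And>x. GDERIV \<phi> x :> G x" "\<And>x. G x \<in> (\<lambda>z. z - p) ` L k"
      "\<And>x. 1 \<le> norm x \<Longrightarrow> \<phi> x = 0 \<and> G x = 0" "\<And>x. \<bar>\<phi> x\<bar> \<le> norm (q k - p)"
      "0 < \<rho>" "\<rho> \<le> 1" "\<And>x. x \<in> ball 0 \<rho> \<Longrightarrow> \<phi> x = (q k - p) \<bullet> x \<and> G x = q k - p"
      by (fact cutoff_linear[OF conv int0 intq])
    show ?thesis
      using * order_trans[OF *(4) q_le]
      by (intro exI[of _ \<phi>] exI[of _ G] exI[of _ \<rho>] conjI) auto
  qed
  then obtain \<phi> G \<rho> where \<phi>: "\<And>k x. GDERIV (\<phi> k) x :> G k x"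
      "\<And>k. \<forall>x. 1 \<le> norm x \<longrightarrow> \<phi> k x = 0 \<and> G k x = 0" "\<And>k x. \<bar>\<phi> k x\<bar> \<le> 2"
    and G_in: "\<And>k x. G k x \<in> (\<lambda>z. z - p) ` L k"
    and \<rho>: "\<And>k. 0 < \<rho> k \<and> \<rho> k \<le> 1" and G_near: "\<And>k x. x \<in> ball 0 (\<rho> k) \<Longrightarrow> G k x = q k - p"
    by metis
  have t_le: "\<bar>t k\<bar> \<le> 2" for k
    using code_bounds[of "L k"] L(3)[of k] by auto
  obtain r a h H where
    r: "\<And>k. 0 < r k \<and> r k \<le> (1/2) ^ k" and
    a: "\<And>k. dist (a k) (t k *\<^sub>R e1) \<le> (1/2) ^ k" and
    in_ball: "\<And>k x. x \<in> ball (a k) (r k) \<Longrightarrow> \<bar>x \<bullet> e1 - t k\<bar> \<le> x \<bullet> e2" and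
    h: "\<And>x. GDERIV h x :> H x" and
    H_ball: "\<And>k x. x \<in> ball (a k) (r k) \<Longrightarrow> H x = G k ((x - a k) /\<^sub>R r k)" and
    H_out: "\<And>x. (\<And>k. x \<notin> ball (a k) (r k)) \<Longrightarrow> H x = 0" and
    h_supp: "\<And>x. 4 \<le> norm x \<Longrightarrow> h x = 0 \<and> H x = 0"
    by (fact glue_bumps[where t = t and \<phi> = \<phi> and G = G, OF e t_le \<phi>])
  have H_in: "p + H x \<in> L k" if "x \<in> ball (a k) (r k)" for k x
    using H_ball[OF that] G_in[of k "(x - a k) /\<^sub>R r k"] by auto
  have H_norm: "norm (p + H x) \<le> 1" for x
  proof (cases "\<exists>k. x \<in> ball (a k) (r k)")
    case True
    then show ?thesis using H_in L_sub by (force simp: subset_iff)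
  next
    case False
    then show ?thesis using H_out[of x] p by auto
  qed
  have realizes_H: "realizes (\<lambda>y. p + H y) K (code K *\<^sub>R e1)" if K: "K \<in> \<K>" for K
    unfolding realizes_def
  proof (intro conjI allI ballI impI)
    let ?x = "code K *\<^sub>R e1"
    have KK: "convex K" "compact K" "p \<in> interior K"
      using K by (auto simp: \<K>_def convex_body_def)
    {
      fix \<epsilon> :: real assume \<epsilon>: "\<epsilon> > 0"
      obtain \<delta> where \<delta>: "\<delta> > 0" "\<And>K'. K' \<subseteq> cball 0 1 \<Longrightarrow> \<bar>code K' - code K\<bar> < \<delta> \<Longrightarrow>
          \<forall>z\<in>K'. \<exists>w\<in>K. dist z w < \<epsilon>"
        using code_close[OF KK(2) \<epsilon>] by blast
      \<comment> \<open>If \<open>y\<close> lies in bump \<open>k\<close>, its height is below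
        \<open>\<delta>/2\<close>, so \<open>t k\<close> is within \<open>\<delta>\<close> of
        \<open>code K\<close> and the gradient, lying in \<open>L k\<close>, is close to
        \<open>K\<close>. Off the bumps the gradient is \<open>p\<close>.\<close>
      have "\<exists>z\<in>K. dist (p + H y) z < \<epsilon>" if y: "y \<in> ball ?x (\<delta>/2)" for y
      proof (cases "\<exists>k. y \<in> ball (a k) (r k)")
        case True
        then obtain k where k: "y \<in> ball (a k) (r k)" by auto
        have "norm (y - ?x) < \<delta>/2"
          using y by (simp add: dist_norm norm_minus_commute)
        then have "\<bar>y \<bullet> e1 - code K\<bar> < \<delta>/2" "\<bar>y \<bullet> e2\<bar> < \<delta>/2"
          using Cauchy_Schwarz_ineq2[of "y - ?x" e1] Cauchy_Schwarz_ineq2[of "y - ?x" e2] e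
          by (simp_all add: inner_diff_left dot_square_norm)
        then have "\<bar>code (L k) - code K\<bar> < \<delta>"
          using in_ball[OF k] L(3)[of k] by linarith
        then show ?thesis using \<delta>(2)[OF L_sub] H_in[OF k] by blast
      next
        case False
        then show ?thesis using H_out[of y] KK(3) \<epsilon> interior_subset by (intro bexI[of _ p]) auto
      qed
      then show "\<exists>\<delta>>0. \<forall>y\<in>ball ?x \<delta>. \<exists>z\<in>K. dist (p + H y) z < \<epsilon>"
        using \<delta>(1) by (intro exI[of _ "\<delta>/2"]) auto
    next
      fix z and \<epsilon> :: real assume z: "z \<in> K" and \<epsilon>: "\<epsilon> > 0"
      \<comment> \<open>Only interior points occur in \<open>T\<close>; they are dense in
        \<open>K\<close> by convexity.\<close>
      have "interior K \<noteq> {}" using KK(3) by auto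
      then have "z \<in> closure (interior K)"
        using convex_closure_interior[OF KK(1)] z closure_subset by blast
      then obtain z' where z': "z' \<in> interior K" "dist z' z < \<epsilon>/8"
        using \<epsilon> unfolding closure_approachable by (meson divide_pos_pos zero_less_numeral)
      then have "(code K, z') \<in> closure D"
        using K D(3) by (auto simp: T_def)
      then obtain c where c: "c \<in> D" "dist c (code K, z') < \<epsilon>/8"
        using \<epsilon> unfolding closure_approachable by (meson divide_pos_pos zero_less_numeral)
      obtain m where m: "(1/2) ^ m < \<epsilon>/4"
        using real_arch_pow_inv[of "\<epsilon>/4" "1/2"] \<epsilon> by auto
      \<comment> \<open>An occurrence of \<open>c\<close> with index at least \<open>m\<close>, so
        that its bump is small and close to the axis.\<close>
      define k where "k = prod_encode (to_nat_on D c, m)"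
      have dk: "d k = c"
        using c(1) D(1) by (simp add: d_def k_def)
      have "\<bar>t k - code K\<bar> < \<epsilon>/8" "dist (q k) z' < \<epsilon>/8"
        using c(2) dist_fst_le[of c "(code K, z')"] dist_snd_le[of c "(code K, z')"]
        by (auto simp: t_def q_def dk dist_real_def)
      then have qz: "dist (q k) z < \<epsilon>"
        using z'(2) dist_triangle[of "q k" z z'] \<epsilon> by linarith
      have "(1/2::real) ^ k \<le> (1/2) ^ m"
        by (intro power_decreasing) (auto simp: k_def le_prod_encode_2)
      then have small: "(1/2::real) ^ k < \<epsilon>/4" using m by linarith
      \<comment> \<open>On this smaller concentric ball the bump has constant gradient
        \<open>q k - p\<close>.\<close>
      define U where "U = ball (a k) (r k * \<rho> k)"
      have "r k * \<rho> k > 0"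
        using r \<rho> by (intro mult_pos_pos) auto
      then have "open U" "U \<noteq> {}"
        unfolding U_def ball_eq_empty by simp_all
      have U_sub: "U \<subseteq> ball (a k) (r k)"
        unfolding U_def using r[of k] \<rho>[of k] by (intro subset_ball) (simp add: mult_left_le)
      have "dist ?x y < \<epsilon>" if "y \<in> U" for y
      proof -
        have "dist (a k) y < \<epsilon>/4"
          using that U_sub r[of k] small by force
        moreover have "dist (t k *\<^sub>R e1) ?x < \<epsilon>/8"
          using \<open>\<bar>t k - code K\<bar> < \<epsilon>/8\<close> e(1) by (simp add: dist_norm scaleR_diff_left[symmetric])
        ultimately show ?thesis
          using a[of k] small \<epsilon> dist_triangle[of ?x y "a k"] dist_triangle[of ?x "a k" "t k *\<^sub>R e1"]
            dist_commute[of "a k" "t k *\<^sub>R e1"] dist_commute[of ?x "t k *\<^sub>R e1"]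
          by linarith
      qed
      moreover have "dist (p + H y) z < \<epsilon>" if "y \<in> U" for y
      proof -
        have "0 < r k" using r by blast
        then have "norm ((y - a k) /\<^sub>R r k) = dist (a k) y / r k"
          by (simp add: dist_norm norm_minus_commute divide_inverse_commute)
        also have "\<dots> < \<rho> k"
          using that \<open>0 < r k\<close> by (simp add: U_def pos_divide_less_eq mult.commute[of "\<rho> k"])
        finally have "(y - a k) /\<^sub>R r k \<in> ball 0 (\<rho> k)"
          by (simp only: mem_ball_0)
        then have "H y = q k - p"
          using H_ball[of y k] G_near that U_sub by auto
        then show ?thesis using qz by simp
      qed
      ultimately show "\<exists>U. open U \<and> U \<noteq> {} \<and> U \<subseteq> ball ?x \<epsilon> \<and> (\<forall>y\<in>U. dist (p + H y) z < \<epsilon>)"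
        using \<open>open U\<close> \<open>U \<noteq> {}\<close> by (intro exI[of _ U]) auto
    }
  qed
  \<comment> \<open>Taking the unit ball as the convex set keeps the gradients of this cutoff at
    norm at most 1.\<close>
  obtain \<phi>\<^sub>0 G\<^sub>0 \<rho>\<^sub>0 where \<phi>\<^sub>0: "\<And>x. GDERIV \<phi>\<^sub>0 x :> G\<^sub>0 x"
    and G\<^sub>0: "\<And>x. G\<^sub>0 x \<in> cball 0 1"
    and supp\<^sub>0: "\<And>x. 1 \<le> norm x \<Longrightarrow> \<phi>\<^sub>0 x = 0 \<and> G\<^sub>0 x = 0"
    and \<rho>\<^sub>0: "0 < \<rho>\<^sub>0" "\<rho>\<^sub>0 \<le> 1"
    and near\<^sub>0: "\<And>x. x \<in> ball 0 \<rho>\<^sub>0 \<Longrightarrow> \<phi>\<^sub>0 x = p \<bullet> x \<and> G\<^sub>0 x = p"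
    by (rule cutoff_linear[of "cball 0 1" p]) (use p in auto)
  \<comment> \<open>The scaled bumps live within radius \<open>4 * c < \<rho>\<^sub>0\<close>, where
    the gradient of \<open>\<phi>\<^sub>0\<close> is \<open>p\<close>. The points
    \<open>c * code K\<close> on the axis have norm at most \<open>3/2 * c\<close>, so balls of
    radius \<open>c\<close> around them also stay there.\<close>
  define c where "c = \<rho>\<^sub>0 / 5"
  have c: "c > 0" "5 * c = \<rho>\<^sub>0" using \<rho>\<^sub>0 by (auto simp: c_def)
  define f where "f x = \<phi>\<^sub>0 x + c * h ((x - 0) /\<^sub>R c)" for x
  define F where "F x = G\<^sub>0 x + H ((x - 0) /\<^sub>R c)" for x
  have outer: "h ((x - 0) /\<^sub>R c) = 0 \<and> H ((x - 0) /\<^sub>R c) = 0" if "\<rho>\<^sub>0 \<le> norm x" for x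
    using that c by (intro h_supp) (simp add: field_simps)
  have inner: "F x = p + H ((x - 0) /\<^sub>R c)" if "norm x < \<rho>\<^sub>0" for x
    using that near\<^sub>0[of x] by (simp add: F_def)
  show thesis
  proof (rule that[of f F])
    show "GDERIV f x :> F x" for x
      using \<phi>\<^sub>0[of x] GDERIV_rescale[where x = x and a = 0, OF h c(1)]
      unfolding f_def F_def gderiv_def inner_add_right by (rule has_derivative_add)
    show "norm (F x) \<le> 1" for x
    proof (cases "norm x < \<rho>\<^sub>0")
      case True
      then show ?thesis using inner H_norm by simp
    next
      case False
      then show ?thesis using outer[of x] G\<^sub>0[of x] by (simp add: F_def)
    qed
    show "f x = 0 \<and> F x = 0" if "1 \<le> norm x" for x
      using that supp\<^sub>0[of x] outer[of x] \<rho>\<^sub>0 by (simp add: f_def F_def)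
    show "\<exists>x\<in>ball 0 1. realizes F K x" if "convex_body K" "K \<subseteq> cball 0 1" "p \<in> interior K" for K
    proof (intro bexI)
      let ?x = "0 + c *\<^sub>R (code K *\<^sub>R e1)"
      have "c * code K \<le> c * (3/2)"
        using code_bounds[of K] c by (intro mult_left_mono) auto
      then have norm_x: "norm ?x \<le> c * (3/2)"
        using e(1) c(1) code_bounds[of K] by (simp add: abs_mult)
      then show "?x \<in> ball 0 1" using c \<rho>\<^sub>0 by simp
      show "realizes F K ?x"
      proof (rule realizes_rescale[where G = "\<lambda>y. p + H y" and d = c])
        show "realizes (\<lambda>y. p + H y) K (code K *\<^sub>R e1)"
          using that by (intro realizes_H) (simp add: \<K>_def)
        show "F y = p + H ((y - 0) /\<^sub>R c)" if "y \<in> ball ?x c" for y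
        proof (rule inner)
          have "norm (y - ?x) < c"
            using that by (metis dist_commute dist_norm mem_ball)
          then show "norm y < \<rho>\<^sub>0"
            using norm_x c norm_triangle_ineq2[of y ?x] by linarith
        qed
      qed (use c in auto)
    qed
  qed
qed

section \<open>All bodies at once\<close>

text \<open>The interior of every body meets a countable dense subset of the unit ball. The
  functions belonging to its points are themselves glued as bumps, so all their gradient fields
  occur at smaller scales.\<close>

lemma universal_realizer:
  fixes e1 e2 :: "'a::euclidean_space"
  assumes e: "norm e1 = 1" "norm e2 = 1" "e1 \<bullet> e2 = 0"
  obtains f F where
    "\<And>x::'a. GDERIV f x :> F x"
    "\<And>x. norm (F x) \<le> 1"
    "\<And>x. 4 \<le> norm x \<Longrightarrow> f x = 0"
    "\<And>K. convex_body K \<Longrightarrow> K \<subseteq> cball 0 1 \<Longrightarrow> \<exists>x. realizes F K x"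
proof -
  obtain D where D: "countable D" "D \<subseteq> ball 0 1" "ball (0::'a) 1 \<subseteq> closure D"
    using separable[of "ball (0::'a) 1"] by blast
  then have "D \<noteq> {}" by auto
  define p where "p = from_nat_into D"
  have p: "norm (p k) < 1" for k
    using from_nat_into[OF \<open>D \<noteq> {}\<close>, of k] D(2) by (auto simp: p_def subset_iff)
  have "\<forall>k. \<exists>g G. (\<forall>x. GDERIV g x :> G x) \<and> (\<forall>x. norm (G x) \<le> 1) \<and>
      (\<forall>x. 1 \<le> norm x \<longrightarrow> g x = 0 \<and> G x = 0) \<and>
      (\<forall>K. convex_body K \<longrightarrow> K \<subseteq> cball 0 1 \<longrightarrow> p k \<in> interior K \<longrightarrow> (\<exists>x\<in>ball 0 1. realizes G K x))"
      (is "\<forall>k. ?P k")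
  proof
    fix k
    show "?P k"
      by (rule realizer_with_interior_point[OF e p[of k]]) blast
  qed
  then obtain g G where g: "\<And>k x. GDERIV (g k) x :> G k x"
    and G: "\<And>k x. norm (G k x) \<le> 1"
    and supp: "\<And>k. \<forall>x. 1 \<le> norm x \<longrightarrow> g k x = 0 \<and> G k x = 0"
    and real: "\<And>k K. convex_body K \<Longrightarrow> K \<subseteq> cball 0 1 \<Longrightarrow> p k \<in> interior K \<Longrightarrow>
      \<exists>x\<in>ball 0 1. realizes (G k) K x"
    by metis
  \<comment> \<open>\<open>g k\<close> is 1-Lipschitz and vanishes at the unit vector
    \<open>e1\<close>, which is at distance at most 2 from points of the unit ball.\<close>
  have g_le: "\<bar>g k x\<bar> \<le> 2" for k x
  proof (cases "1 \<le> norm x")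
    case False
    have "dist (g k x) (g k e1) \<le> 1 * dist x e1"
      using GDERIV_bound_imp_lipschitz[OF g G] by (rule lipschitz_onD) auto
    moreover have "dist x e1 \<le> 2"
      using False e(1) norm_triangle_ineq4[of x e1] by (simp add: dist_norm)
    ultimately show ?thesis
      using supp[of k] e(1) by (simp add: dist_real_def)
  qed (use supp in simp)
  \<comment> \<open>With all positions along \<open>e1\<close> equal to 0, the bumps shrink towards
    the origin.\<close>
  have "\<bar>0::real\<bar> \<le> 2" by simp
  obtain r a f F where
    r: "\<And>k. 0 < r k \<and> r k \<le> (1/2) ^ k" and
    "\<And>k. dist (a k) (0 *\<^sub>R e1) \<le> (1/2) ^ k" and
    "\<And>k x. x \<in> ball (a k) (r k) \<Longrightarrow> \<bar>x \<bullet> e1 - 0\<bar> \<le> x \<bullet> e2" and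
    f: "\<And>x. GDERIV f x :> F x" and
    F_ball: "\<And>k x. x \<in> ball (a k) (r k) \<Longrightarrow> F x = G k ((x - a k) /\<^sub>R r k)" and
    F_out: "\<And>x. (\<And>k. x \<notin> ball (a k) (r k)) \<Longrightarrow> F x = 0" and
    f_supp: "\<And>x. 4 \<le> norm x \<Longrightarrow> f x = 0 \<and> F x = 0"
    by (fact glue_bumps[where t = "\<lambda>_. 0" and \<phi> = g and G = G, OF e \<open>\<bar>0\<bar> \<le> 2\<close> g supp g_le])
  show thesis
  proof (rule that[of f F])
    show "norm (F x) \<le> 1" for x
      using F_ball F_out G by (metis norm_zero zero_le_one)
    show "\<exists>x. realizes F K x" if K: "convex_body K" "K \<subseteq> cball 0 1" for K
    proof -
      have "interior K \<subseteq> ball 0 1"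
        using interior_mono[OF K(2)] by simp
      moreover obtain z where z: "z \<in> interior K"
        using K(1) by (auto simp: convex_body_def)
      ultimately have "z \<in> closure D" using D(3) by blast
      then obtain y where "y \<in> D" "y \<in> interior K"
        using z open_Int_closure_eq_empty[OF open_interior, of K D] by blast
      then obtain k where k: "p k \<in> interior K"
        unfolding p_def using D(1) from_nat_into_to_nat_on by metis
      then obtain x where x: "norm x < 1" "realizes (G k) K x"
        using real[OF K k] by auto
      \<comment> \<open>The ball of radius \<open>r k * (1 - norm x)\<close> around the image of
        \<open>x\<close> stays inside bump \<open>k\<close>, where \<open>F\<close> is the rescaled
        \<open>G k\<close>.\<close>
      have "realizes F K (a k + r k *\<^sub>R x)"
      proof (rule realizes_rescale[OF x(2)])
        show "r k > 0" "r k * (1 - norm x) > 0" using r[of k] x by auto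
        show "F y = G k ((y - a k) /\<^sub>R r k)" if "y \<in> ball (a k + r k *\<^sub>R x) (r k * (1 - norm x))" for y
        proof (rule F_ball)
          have "dist (a k) y \<le> norm (r k *\<^sub>R x) + dist (a k + r k *\<^sub>R x) y"
            using dist_triangle[of "a k" y "a k + r k *\<^sub>R x"] by (simp add: dist_norm)
          then show "y \<in> ball (a k) (r k)"
            using that r[of k] by (simp add: algebra_simps)
        qed
      qed
      then show ?thesis ..
    qed
  qed (use f f_supp in auto)
qed

theorem theorem3p12:
  assumes "CARD('n::finite) \<ge> 2"
  shows "\<exists>f :: real ^ 'n \<Rightarrow> real.
           compactly_supported f \<and>
           (\<forall>x. f differentiable (at x)) \<and>
           1-lipschitz_on UNIV f \<and>
           (\<forall>K. convex_body K \<and> K \<subseteq> cball 0 1 \<longrightarrow>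
              (\<exists>x. \<forall>N \<in> null_sets lebesgue. clarke_subdifferential N f x = K))"
proof -
  \<comment> \<open>Dimension at least 2 provides an axis carrying the codes and an orthogonal
    direction from which the bumps approach it.\<close>
  obtain i j :: 'n where "i \<noteq> j"
    using assms card_le_Suc0_iff_eq[of "UNIV :: 'n set"] by fastforce
  then have e: "norm (axis i 1 :: real ^ 'n) = 1" "norm (axis j 1 :: real ^ 'n) = 1"
    "axis i 1 \<bullet> (axis j 1 :: real ^ 'n) = 0"
    by (simp_all add: inner_axis_axis)
  obtain f :: "real ^ 'n \<Rightarrow> real" and F where
    f: "\<And>x. GDERIV f x :> F x" "\<And>x. norm (F x) \<le> 1" and
    supp: "\<And>x. 4 \<le> norm x \<Longrightarrow> f x = 0" and
    real: "\<And>K. convex_body K \<Longrightarrow> K \<subseteq> cball 0 1 \<Longrightarrow> \<exists>x. realizes F K x"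
    using universal_realizer[OF e] by blast
  show ?thesis
  proof (intro exI[of _ f] conjI allI impI)
    have "{x. f x \<noteq> 0} \<subseteq> cball 0 4"
      using supp by (force simp: not_le)
    then show "compactly_supported f"
      unfolding compactly_supported_def compact_closure by (rule bounded_subset[OF bounded_cball])
    show "f differentiable (at x)" for x
      using f(1) unfolding gderiv_def differentiable_def by blast
    show "1-lipschitz_on UNIV f"
      using f by (rule GDERIV_bound_imp_lipschitz)
    show "\<exists>x. \<forall>N \<in> null_sets lebesgue. clarke_subdifferential N f x = K"
      if "convex_body K \<and> K \<subseteq> cball 0 1" for K
      using that real[of K] clarke_subdifferential_eq_if_realizes[OF f(1)]
      unfolding convex_body_def by blast
  qed
qed

end
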